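(* Let $\mu=(\mu_1,\dots,\mu_d)'$ be the vector of market weights, $A\in CBV([0,T],\mathbb{R}^m)$, and let $G:\mathbb{R}^d\times\mathbb{R}^m\to\mathbb{R}$ be a regular function for the pair $(\mu,A)$. Let $\varphi=(\varphi_1,\dots,\varphi_d)'$ be the trading strategy additively generated by $G$. Then its value $V^\varphi(t)=\sum_{i=1}^d\varphi_i(t)\mu_i(t)$ is $$V^\varphi(t)=G(\mu(t),A(t))+\Gamma^G(t),\qquad 0\le t\le T,$$ and its components can be represented, for $i=1,\dots,d$ and $0\le t\le T$, as $$\varphi_i(t)=\partial_iG(\mu(t),A(t))+\Gamma^G(t)+G(\mu(t),A(t))-\sum_{j=1}^d\mu_j(t)\,\partial_jG(\mu(t),A(t))=V^\varphi(t)+\partial_iG(\mu(t),A(t))-\sum_{j=1}^d\mu_j(t)\,\partial_jG(\mu(t),A(t)).$$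
   Context: Partitions: $T>0$ is fixed, and $(\mathbb{T}_n)_{n\in\mathbb{N}}$ is a fixed sequence of finite partitions of $[0,T]$ (containing $0$ and $T$) with $\mathbb{T}_1\subset\mathbb{T}_2\subset\cdots$ and mesh tending to $0$. $[t_j,t_{j+1}]\in\mathbb{T}_n$ means that $t_j<t_{j+1}$ are consecutive points of $\mathbb{T}_n$; in sums over $[t_j,t_{j+1}]\in\mathbb{T}_n$ with $t_j\le t$, $t_{j+1}$ is replaced by $t$ when $j$ is the largest index with $t_j\le t$. Market weights: $S_1,\dots,S_d:[0,T]\to[0,\infty)$ ($d\ge2$) are continuous with $S_i(0)>0$ and $S_1(t)+\dots+S_d(t)>0$ for all $t$; $\mu_i(t)=S_i(t)/(S_1(t)+\dots+S_d(t))$. It is assumed that $\mu$ has pathwise quadratic covariations along $(\mathbb{T}_n)$: for all $i,k$ and $t$ the limit $\langle\mu_i,\mu_k\rangle(t)=\lim_n\sum_{[t_j,t_{j+1}]\in\mathbb{T}_n,\,t_j\le t}(\mu_i(t_{j+1})-\mu_i(t_j))(\mu_k(t_{j+1})-\mu_k(t_j))$ exists and is real-valued and continuous in $t$. $CBV([0,T],\mathbb{R}^m)$: continuous $\mathbb{R}^m$-valued functions of bounded variation on $[0,T]$. $\mathbb{C}^{2,1}$: functions on $\mathbb{R}^{d+m}$ twice continuously differentiable in the first $d$ variables and once continuously differentiable in the last $m$ variables; $\partial_i$ denotes the derivative in the $i$-th of the first $d$ variables. Integral: $\int_0^t\sum_{i=1}^d\partial_iG(\mu(s),A(s))\,d\mu_i(s):=\lim_{n}\sum_{[t_j,t_{j+1}]\in\mathbb{T}_n,\,t_j\le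 t}\sum_{i=1}^d\partial_iG(\mu(t_j),A(t_j))(\mu_i(t_{j+1})-\mu_i(t_j))$ (the limit exists by the pathwise Itô formula). Regular function: $G\in\mathbb{C}^{2,1}$ is regular for $(\mu,A)$ if $\Gamma^G(t):=G(\mu(0),A(0))-G(\mu(t),A(t))+\int_0^t\sum_i\partial_iG(\mu(s),A(s))\,d\mu_i(s)$, $0\le t\le T$, has finite variation on compact intervals of $[0,T]$. Additive generation: put $\vartheta_i(t)=\partial_iG(\mu(t),A(t))$, $V^\vartheta(t)=\sum_i\vartheta_i(t)\mu_i(t)$, $Q^\vartheta(t)=V^\vartheta(t)-V^\vartheta(0)-\int_0^t\sum_i\vartheta_i(s)\,d\mu_i(s)$, and $C(0)=\sum_i\partial_iG(\mu(0),A(0))\mu_i(0)-G(\mu(0),A(0))$. The trading strategy additively generated by $G$ is $\varphi_i(t)=\vartheta_i(t)-Q^\vartheta(t)-C(0)$, $i=1,\dots,d$. *)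

theory Defs
  imports "HOL-Analysis.Analysis"
begin

text \<open>A partition is represented by its finite set of points; the pairs \<open>(a, b)\<close> of consecutive
  points are its intervals \<open>[t\<^sub>j, t\<^sub>j\<^sub>+\<^sub>1]\<close>.\<close>

definition partition_of :: "real \<Rightarrow> real \<Rightarrow> real set \<Rightarrow> bool" where
  "partition_of a b P \<longleftrightarrow> finite P \<and> {a, b} \<subseteq> P \<and> P \<subseteq> {a..b}"

definition intervals :: "real set \<Rightarrow> (real \<times> real) set" where
  "intervals P = {(a, b). a \<in> P \<and> b \<in> P \<and> a < b \<and> P \<inter> {a<..<b} = {}}"

definition mesh :: "real set \<Rightarrow> real" where
  "mesh P = Max ((\<lambda>(a, b). b - a) ` intervals P)"

definition refining_partitions :: "real \<Rightarrow> (nat \<Rightarrow> real set) \<Rightarrow> bool" where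
  "refining_partitions T P \<longleftrightarrow>
     (\<forall>n. partition_of 0 T (P n)) \<and> (\<forall>n. P n \<subseteq> P (Suc n)) \<and> (\<lambda>n. mesh (P n)) \<longlonglongrightarrow> 0"

definition bounded_variation_on :: "(real \<Rightarrow> 'a::real_normed_vector) \<Rightarrow> real \<Rightarrow> real \<Rightarrow> bool" where
  "bounded_variation_on f a b \<longleftrightarrow>
     (\<exists>B. \<forall>P. partition_of a b P \<longrightarrow> (\<Sum>(s, u)\<in>intervals P. norm (f u - f s)) \<le> B)"

definition CBV :: "real \<Rightarrow> (real \<Rightarrow> 'a::real_normed_vector) set" where
  "CBV T = {f. continuous_on {0..T} f \<and> bounded_variation_on f 0 T}"

definition dir_deriv :: "'a::real_normed_vector \<Rightarrow> ('a \<Rightarrow> real) \<Rightarrow> 'a \<Rightarrow> real" where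
  "dir_deriv v F z = deriv (\<lambda>h. F (z + h *\<^sub>R v)) 0"

definition has_cont_dir_deriv :: "'a::real_normed_vector \<Rightarrow> ('a \<Rightarrow> real) \<Rightarrow> bool" where
  "has_cont_dir_deriv v F \<longleftrightarrow>
     (\<forall>z. (\<lambda>h. F (z + h *\<^sub>R v)) field_differentiable (at 0)) \<and> continuous_on UNIV (dir_deriv v F)"

definition xdir :: "'d::finite \<Rightarrow> (real^'d) \<times> (real^'m::finite)" where
  "xdir i = (axis i 1, 0)"

definition adir :: "'m::finite \<Rightarrow> (real^'d::finite) \<times> (real^'m)" where
  "adir k = (0, axis k 1)"

abbreviation pd :: "'d::finite \<Rightarrow> ((real^'d) \<times> (real^'m::finite) \<Rightarrow> real) \<Rightarrow> (real^'d) \<times> (real^'m) \<Rightarrow> real" where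
  "pd i G \<equiv> dir_deriv (xdir i) G"

text \<open>All partial derivatives are required to be continuous jointly in all \<open>d + m\<close> variables.\<close>

definition C21 :: "((real^'d::finite) \<times> (real^'m::finite) \<Rightarrow> real) set" where
  "C21 = {G. (\<forall>i. has_cont_dir_deriv (xdir i) G) \<and>
             (\<forall>i j. has_cont_dir_deriv (xdir j) (pd i G)) \<and>
             (\<forall>k. has_cont_dir_deriv (adir k) G)}"

definition price_path :: "real \<Rightarrow> (real \<Rightarrow> real^'d::finite) \<Rightarrow> bool" where
  "price_path T S \<longleftrightarrow>
     continuous_on {0..T} S \<and> (\<forall>t\<in>{0..T}. \<forall>i. 0 \<le> S t $ i) \<and>
     (\<forall>i. 0 < S 0 $ i) \<and> (\<forall>t\<in>{0..T}. 0 < (\<Sum>i\<in>UNIV. S t $ i))"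

definition market_weights :: "(real \<Rightarrow> real^'d::finite) \<Rightarrow> real \<Rightarrow> real^'d" where
  "market_weights S t = (\<chi> i. S t $ i / (\<Sum>k\<in>UNIV. S t $ k))"

text \<open>In sums over the intervals \<open>[s, u]\<close> with \<open>s \<le> t\<close>, the right endpoint \<open>u\<close> of the last interval is
  to be replaced by \<open>t\<close>. As \<open>u \<le> t\<close> for all the other ones, this is \<open>min u t\<close> throughout.\<close>

definition intervals_upto :: "real set \<Rightarrow> real \<Rightarrow> (real \<times> real) set" where
  "intervals_upto P t = {(s, u) \<in> intervals P. s \<le> t}"

definition covariation_sum :: "real set \<Rightarrow> (real \<Rightarrow> real) \<Rightarrow> (real \<Rightarrow> real) \<Rightarrow> real \<Rightarrow> real" where
  "covariation_sum P f g t =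
     (\<Sum>(s, u)\<in>intervals_upto P t. (f (min u t) - f s) * (g (min u t) - g s))"

definition covariation :: "(nat \<Rightarrow> real set) \<Rightarrow> (real \<Rightarrow> real) \<Rightarrow> (real \<Rightarrow> real) \<Rightarrow> real \<Rightarrow> real" where
  "covariation P f g t = lim (\<lambda>n. covariation_sum (P n) f g t)"

definition has_covariations :: "real \<Rightarrow> (nat \<Rightarrow> real set) \<Rightarrow> (real \<Rightarrow> real^'d::finite) \<Rightarrow> bool" where
  "has_covariations T P \<mu> \<longleftrightarrow>
     (\<forall>i k. (\<forall>t\<in>{0..T}. convergent (\<lambda>n. covariation_sum (P n) (\<lambda>s. \<mu> s $ i) (\<lambda>s. \<mu> s $ k) t)) \<and>
            continuous_on {0..T} (covariation P (\<lambda>s. \<mu> s $ i) (\<lambda>s. \<mu> s $ k)))"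

text \<open>For integrands \<open>\<partial>\<^sub>i G(\<mu>, A)\<close> with \<open>G\<close> in \<open>\<complex>\<^sup>2\<^sup>,\<^sup>1\<close>, \<open>A\<close> in \<open>CBV\<close> and \<open>\<mu>\<close> with covariations, the limit exists
  by the pathwise Ito formula.\<close>

definition path_integral ::
  "(nat \<Rightarrow> real set) \<Rightarrow> (real \<Rightarrow> real^'d::finite) \<Rightarrow> (real \<Rightarrow> real^'d) \<Rightarrow> real \<Rightarrow> real" where
  "path_integral P \<theta> \<mu> t =
     lim (\<lambda>n. \<Sum>(s, u)\<in>intervals_upto (P n) t. \<Sum>i\<in>UNIV. \<theta> s $ i * (\<mu> (min u t) $ i - \<mu> s $ i))"

definition gradient_path ::
  "((real^'d::finite) \<times> (real^'m::finite) \<Rightarrow> real) \<Rightarrow> (real \<Rightarrow> real^'d) \<Rightarrow> (real \<Rightarrow> real^'m) \<Rightarrow> real \<Rightarrow> real^'d" where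
  "gradient_path G \<mu> A t = (\<chi> i. pd i G (\<mu> t, A t))"

definition Gamma_path ::
  "(nat \<Rightarrow> real set) \<Rightarrow> ((real^'d::finite) \<times> (real^'m::finite) \<Rightarrow> real) \<Rightarrow>
   (real \<Rightarrow> real^'d) \<Rightarrow> (real \<Rightarrow> real^'m) \<Rightarrow> real \<Rightarrow> real" where
  "Gamma_path P G \<mu> A t =
     G (\<mu> 0, A 0) - G (\<mu> t, A t) + path_integral P (gradient_path G \<mu> A) \<mu> t"

definition regular_for ::
  "real \<Rightarrow> (nat \<Rightarrow> real set) \<Rightarrow> ((real^'d::finite) \<times> (real^'m::finite) \<Rightarrow> real) \<Rightarrow>
   (real \<Rightarrow> real^'d) \<Rightarrow> (real \<Rightarrow> real^'m) \<Rightarrow> bool" where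
  "regular_for T P G \<mu> A \<longleftrightarrow> G \<in> C21 \<and>
     (\<forall>a b. 0 \<le> a \<and> a \<le> b \<and> b \<le> T \<longrightarrow> bounded_variation_on (Gamma_path P G \<mu> A) a b)"

definition portfolio_value :: "(real \<Rightarrow> real^'d::finite) \<Rightarrow> (real \<Rightarrow> real^'d) \<Rightarrow> real \<Rightarrow> real" where
  "portfolio_value \<theta> \<mu> t = (\<Sum>i\<in>UNIV. \<theta> t $ i * \<mu> t $ i)"

definition self_financing_defect ::
  "(nat \<Rightarrow> real set) \<Rightarrow> (real \<Rightarrow> real^'d::finite) \<Rightarrow> (real \<Rightarrow> real^'d) \<Rightarrow> real \<Rightarrow> real" where
  "self_financing_defect P \<theta> \<mu> t =
     portfolio_value \<theta> \<mu> t - portfolio_value \<theta> \<mu> 0 - path_integral P \<theta> \<mu> t"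

definition initial_constant ::
  "((real^'d::finite) \<times> (real^'m::finite) \<Rightarrow> real) \<Rightarrow> (real \<Rightarrow> real^'d) \<Rightarrow> (real \<Rightarrow> real^'m) \<Rightarrow> real" where
  "initial_constant G \<mu> A = (\<Sum>i\<in>UNIV. pd i G (\<mu> 0, A 0) * \<mu> 0 $ i) - G (\<mu> 0, A 0)"

definition additively_generated ::
  "(nat \<Rightarrow> real set) \<Rightarrow> ((real^'d::finite) \<times> (real^'m::finite) \<Rightarrow> real) \<Rightarrow>
   (real \<Rightarrow> real^'d) \<Rightarrow> (real \<Rightarrow> real^'m) \<Rightarrow> real \<Rightarrow> real^'d" where
  "additively_generated P G \<mu> A t =
     (let \<theta> = gradient_path G \<mu> A
      in \<chi> i. \<theta> t $ i - self_financing_defect P \<theta> \<mu> t - initial_constant G \<mu> A)"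

end

theory Submission
  imports Defs
begin

text \<open>The terms \<open>V(0)\<close> in \<open>Q(t)\<close> and in \<open>C(0)\<close> cancel, which leaves
  \<open>\<phi>\<^sub>i = \<partial>\<^sub>iG + (G(\<mu>(0), A(0)) + \<integral> \<Sum>\<^sub>j \<partial>\<^sub>jG d\<mu>\<^sub>j) - \<Sum>\<^sub>j \<mu>\<^sub>j \<partial>\<^sub>jG\<close>, and the bracket is
  \<open>\<Gamma> + G(\<mu>, A)\<close>. Weighting with \<open>\<mu>\<^sub>i\<close>, where \<open>\<Sum>\<^sub>i \<mu>\<^sub>i = 1\<close>, cancels the gradient terms.\<close>

lemma sum_market_weights:
  assumes "(\<Sum>k\<in>UNIV. S t $ k) \<noteq> 0"
  shows "(\<Sum>i\<in>UNIV. market_weights S t $ i) = 1"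
  using assms by (simp add: market_weights_def flip: sum_divide_distrib)

text \<open>The integral enters \<open>self_financing_defect\<close> and \<open>Gamma_path\<close>
  as the same term, so the identity is pure algebra.\<close>

lemma additively_generated_component:
  "additively_generated P G \<mu> A t $ i =
     pd i G (\<mu> t, A t) + Gamma_path P G \<mu> A t + G (\<mu> t, A t)
     - (\<Sum>j\<in>UNIV. \<mu> t $ j * pd j G (\<mu> t, A t))"
  by (simp add: additively_generated_def Let_def self_financing_defect_def portfolio_value_def
      initial_constant_def Gamma_path_def gradient_path_def mult.commute)

lemma portfolio_value_additively_generated:
  assumes "(\<Sum>i\<in>UNIV. \<mu> t $ i) = 1"
  shows "portfolio_value (additively_generated P G \<mu> A) \<mu> t = G (\<mu> t, A t) + Gamma_path P G \<mu> A t"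
proof -
  let ?D = "\<Sum>j\<in>UNIV. \<mu> t $ j * pd j G (\<mu> t, A t)"
  \<comment> \<open>The part of the component that does not depend on the index, so weights of total
    1 reproduce it.\<close>
  let ?c = "Gamma_path P G \<mu> A t + G (\<mu> t, A t) - ?D"
  have "portfolio_value (additively_generated P G \<mu> A) \<mu> t
      = (\<Sum>i\<in>UNIV. \<mu> t $ i * pd i G (\<mu> t, A t) + ?c * \<mu> t $ i)"
    unfolding portfolio_value_def additively_generated_component
    by (intro sum.cong) (auto simp: algebra_simps)
  also have "\<dots> = ?D + ?c * (\<Sum>i\<in>UNIV. \<mu> t $ i)"
    by (simp add: sum.distrib flip: sum_distrib_left)
  finally show ?thesis
    using assms by simp
qed

theorem proposition3p6:
  fixes T :: real
    and P :: "nat \<Rightarrow> real set"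
    and S \<mu> \<phi> :: "real \<Rightarrow> real^'d::finite"
    and A :: "real \<Rightarrow> real^'m::finite"
    and G :: "(real^'d) \<times> (real^'m) \<Rightarrow> real"
  assumes "0 < T"
    and "refining_partitions T P"
    and "2 \<le> CARD('d)"
    and "price_path T S"
    and "\<mu> = market_weights S"
    and "has_covariations T P \<mu>"
    and "A \<in> CBV T"
    and "regular_for T P G \<mu> A"
    and "\<phi> = additively_generated P G \<mu> A"
  shows "(\<forall>t\<in>{0..T}. portfolio_value \<phi> \<mu> t = G (\<mu> t, A t) + Gamma_path P G \<mu> A t) \<and>
         (\<forall>i. \<forall>t\<in>{0..T}.
            \<phi> t $ i = pd i G (\<mu> t, A t) + Gamma_path P G \<mu> A t + G (\<mu> t, A t)
                      - (\<Sum>j\<in>UNIV. \<mu> t $ j * pd j G (\<mu> t, A t)) \<and>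
            \<phi> t $ i = portfolio_value \<phi> \<mu> t + pd i G (\<mu> t, A t)
                      - (\<Sum>j\<in>UNIV. \<mu> t $ j * pd j G (\<mu> t, A t)))"
proof -
  have V: "portfolio_value \<phi> \<mu> t = G (\<mu> t, A t) + Gamma_path P G \<mu> A t" if "t \<in> {0..T}" for t
  proof -
    \<comment> \<open>With total price 0, division by zero would make all weights 0 instead of
      summing to 1.\<close>
    have "(\<Sum>k\<in>UNIV. S t $ k) \<noteq> 0"
      using \<open>price_path T S\<close> that by (force simp: price_path_def)
    then have "(\<Sum>i\<in>UNIV. \<mu> t $ i) = 1"
      unfolding \<open>\<mu> = market_weights S\<close> by (rule sum_market_weights)
    then show ?thesis
      unfolding \<open>\<phi> = additively_generated P G \<mu> A\<close> by (rule portfolio_value_additively_generated)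
  qed
  moreover have "\<phi> t $ i = pd i G (\<mu> t, A t) + Gamma_path P G \<mu> A t + G (\<mu> t, A t)
      - (\<Sum>j\<in>UNIV. \<mu> t $ j * pd j G (\<mu> t, A t))" for t i
    unfolding \<open>\<phi> = additively_generated P G \<mu> A\<close> by (rule additively_generated_component)
  \<comment> \<open>Replacing \<Gamma> + G by the value turns the first representation into the
    second.\<close>
  ultimately show ?thesis
    by simp
qed

end
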